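(* Let $G$ be a polyhedral group, let $\Gamma^p$ be an irreducible matrix representation of $G$ of dimension $d_p$, and let $I_{p;\zeta}$ be an orthonormal basis function for $\Gamma^p$. If $I_{p;\zeta}$ is real-valued, i.e. takes values in $\mathbb{R}^{d_p}$, then for every $g\in G$ the matrix $\Gamma^p(g)$ is a real orthogonal matrix.
   Context: A polyhedral group $G$ is the tetrahedral, octahedral or icosahedral rotation group (the rotational symmetry group of a platonic solid centered at the origin of $\mathbb{R}^3$); $R_g\in\mathbb{R}^{3\times3}$ denotes the rotation matrix of $g\in G$, with $R_{gh}=R_gR_h$. An irreducible matrix representation is given by unitary matrices $\Gamma^p(g)\in\mathbb{C}^{d_p\times d_p}$, $g\in G$. The rotational operator $P(g)$ acts on functions on the unit sphere $S^2\subset\mathbb{R}^3$ by $(P(g)f)(\mathbf{x})=f(R_g^{-1}\mathbf{x})$, and acts componentwise on vector-valued functions. An orthonormal basis function for $\Gamma^p$ is a $d_p$-dimensional vector function $I_{p;\zeta}=(I_{p;\zeta}[1],\dots,I_{p;\zeta}[d_p])^T$ on $S^2$ with square-integrable components such that $$P(g)I_{p;\zeta}(\mathbf{x})=I_{p;\zeta}(R_g^{-1}\mathbf{x})=(\Gamma^p(g))^T I_{p;\zeta}(\mathbf{x})\quad\text{for all } g\in G,$$ and whose components are orthonormal: $(I_{p;\zeta}[i],I_{p;\zeta}[j])=\delta_{i,j}$, where $(f,h)=\int_{S^2}\overline{f}\,h$ is integration over the sphere with respect to surface measure. *)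

theory Defs
  imports "HOL-Analysis.Analysis"
begin

text \<open>A regular \<open>n\<close>-gon of circumradius \<open>r\<close> in space, as a filled convex set; \<open>c\<close> is its
  centre and \<open>u\<close>, \<open>v\<close> is an orthonormal basis of the plane directions.\<close>

definition regular_polygon :: "nat \<Rightarrow> real \<Rightarrow> (real^3) set \<Rightarrow> bool" where
  "regular_polygon n r F \<longleftrightarrow> 3 \<le> n \<and> 0 < r \<and>
     (\<exists>c u v. norm u = 1 \<and> norm v = 1 \<and> u \<bullet> v = 0 \<and>
        F = convex hull ((\<lambda>k. c + (r * cos (2 * pi * real k / real n)) *\<^sub>R u
                                + (r * sin (2 * pi * real k / real n)) *\<^sub>R v) ` {..<n}))"

text \<open>A convex polyhedron whose facets are congruent regular polygons (equal \<open>n\<close> and \<open>r\<close>), with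
  the same number \<open>q\<close> of facets meeting at every vertex.\<close>

definition platonic_solid :: "(real^3) set \<Rightarrow> bool" where
  "platonic_solid S \<longleftrightarrow> polytope S \<and> aff_dim S = 3 \<and>
     (\<exists>n r. \<forall>F. F facet_of S \<longrightarrow> regular_polygon n r F) \<and>
     (\<exists>q. \<forall>v. v extreme_point_of S \<longrightarrow> card {F. F facet_of S \<and> v \<in> F} = q)"

definition centered_at_origin :: "(real^3) set \<Rightarrow> bool" where
  "centered_at_origin S \<longleftrightarrow> (\<Sum>v | v extreme_point_of S. v) = 0"

definition rotational_symmetry_group :: "(real^3) set \<Rightarrow> (real^3^3) set" where
  "rotational_symmetry_group S = {R. rotation_matrix R \<and> (\<lambda>x. R *v x) ` S = S}"

text \<open>Group elements are identified with their rotation matrices, so \<open>R\<^sub>g\<close> is \<open>g\<close> itself and the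
  group operation is the matrix product. Every orientation and size of the solid is allowed.\<close>

definition polyhedral_group :: "(real^3^3) set \<Rightarrow> bool" where
  "polyhedral_group G \<longleftrightarrow>
     (\<exists>S. platonic_solid S \<and> centered_at_origin S \<and> G = rotational_symmetry_group S)"

definition conj_transpose :: "complex^'n^'m \<Rightarrow> complex^'m^'n" where
  "conj_transpose A = (\<chi> i j. cnj (A $ j $ i))"

definition unitary_matrix :: "complex^'n^'n \<Rightarrow> bool" where
  "unitary_matrix A \<longleftrightarrow> conj_transpose A ** A = mat 1 \<and> A ** conj_transpose A = mat 1"

text \<open>The dimension of the representation is \<open>CARD('d)\<close>, and \<open>vec.subspace\<close> refers to complex
  subspaces. That the identity is mapped to the identity follows from unitarity. Since the
  index type is nonempty, the representation space is nonzero.\<close>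

definition unitary_representation ::
  "(real^3^3) set \<Rightarrow> (real^3^3 \<Rightarrow> complex^'d^'d) \<Rightarrow> bool" where
  "unitary_representation G \<Gamma> \<longleftrightarrow>
     (\<forall>g\<in>G. unitary_matrix (\<Gamma> g)) \<and> (\<forall>g\<in>G. \<forall>h\<in>G. \<Gamma> (g ** h) = \<Gamma> g ** \<Gamma> h)"

definition irreducible_unitary_representation ::
  "(real^3^3) set \<Rightarrow> (real^3^3 \<Rightarrow> complex^'d^'d) \<Rightarrow> bool" where
  "irreducible_unitary_representation G \<Gamma> \<longleftrightarrow> unitary_representation G \<Gamma> \<and>
     (\<forall>W. vec.subspace W \<and> (\<forall>g\<in>G. \<forall>w\<in>W. \<Gamma> g *v w \<in> W) \<longrightarrow> W = {0} \<or> W = UNIV)"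

text \<open>Surface measure on the unit sphere, through the parametrisation by polar angle \<open>\<theta>\<close> and
  azimuth \<open>\<phi>\<close> with area element \<open>sin \<theta> d\<theta> d\<phi>\<close>. It is completed, as \<open>lebesgue\<close> is, so that
  measurability on the sphere is Lebesgue measurability.\<close>

definition sphere_param :: "real \<times> real \<Rightarrow> real^3" where
  "sphere_param = (\<lambda>(\<theta>, \<phi>). vector [sin \<theta> * cos \<phi>, sin \<theta> * sin \<phi>, cos \<theta>])"

definition sphere_measure :: "(real^3) measure" where
  "sphere_measure = completion
     (distr (density lborel (\<lambda>(\<theta>, \<phi>). ennreal (sin \<theta>) * indicator ({0..pi} \<times> {0..2 * pi}) (\<theta>, \<phi>)))
        (restrict_space borel (sphere 0 1)) sphere_param)"

definition square_integrable :: "(real^3 \<Rightarrow> complex) \<Rightarrow> bool" where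
  "square_integrable f \<longleftrightarrow> f \<in> borel_measurable sphere_measure \<and>
     integrable sphere_measure (\<lambda>x. (cmod (f x))\<^sup>2)"

definition sphere_inner :: "(real^3 \<Rightarrow> complex) \<Rightarrow> (real^3 \<Rightarrow> complex) \<Rightarrow> complex" where
  "sphere_inner f h = (LINT x|sphere_measure. cnj (f x) * h x)"

definition rotation_op :: "real^3^3 \<Rightarrow> (real^3 \<Rightarrow> 'b) \<Rightarrow> real^3 \<Rightarrow> 'b" where
  "rotation_op g f = (\<lambda>x. f (matrix_inv g *v x))"

text \<open>Functions on the sphere are represented by functions on the whole space, of which only the
  values on the unit sphere matter.\<close>

definition orthonormal_basis_function ::
  "(real^3^3) set \<Rightarrow> (real^3^3 \<Rightarrow> complex^'d^'d) \<Rightarrow> (real^3 \<Rightarrow> complex^'d) \<Rightarrow> bool" where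
  "orthonormal_basis_function G \<Gamma> I \<longleftrightarrow>
     (\<forall>i. square_integrable (\<lambda>x. I x $ i)) \<and>
     (\<forall>g\<in>G. \<forall>x\<in>sphere 0 1. rotation_op g I x = transpose (\<Gamma> g) *v I x) \<and>
     (\<forall>i j. sphere_inner (\<lambda>x. I x $ i) (\<lambda>x. I x $ j) = (if i = j then 1 else 0))"

end

theory Submission
  imports Defs
begin

text \<open>Two facts carry the proof. The components of a basis function are orthonormal, so no
  nontrivial constant linear combination of them vanishes on the whole sphere
  (\<open>orthonormal_components_independent\<close>). And if they are real, the transformation law
  \<open>I (R\<^sub>g\<^sup>-\<^sup>1 x) = (\<Gamma> g)\<^sup>T I x\<close> has a real left-hand side, so taking imaginary parts yields
  \<open>\<Sum>i. Im (\<Gamma> g $ i $ k) * I x $ i = 0\<close> at every \<open>x\<close> of the sphere: a vanishing linear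
  combination with the constant coefficients \<open>Im (\<Gamma> g $ i $ k)\<close>. Hence these coefficients are
  zero and \<open>\<Gamma> g\<close> is real; a real unitary matrix is orthogonal.\<close>

lemma space_sphere_measure [simp]: "space sphere_measure = sphere 0 1"
  by (simp add: sphere_measure_def space_restrict_space)

text \<open>By the inequality \<open>2 * \<bar>a * b\<bar> \<le> \<bar>a\<bar>\<^sup>2 + \<bar>b\<bar>\<^sup>2\<close>. Without integrability of the mixed products
  \<open>sphere_inner\<close> need not be additive, since a divergent integral has the default value \<open>0\<close>.\<close>

lemma integrable_cnj_mult_square_integrable:
  assumes "square_integrable f" and "square_integrable h"
  shows "integrable sphere_measure (\<lambda>x. cnj (f x) * h x)"
proof (rule Bochner_Integration.integrable_bound)
  show "integrable sphere_measure (\<lambda>x. (cmod (f x))\<^sup>2 + (cmod (h x))\<^sup>2)"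
    using assms by (simp add: square_integrable_def)
  have [measurable]: "f \<in> borel_measurable sphere_measure" "h \<in> borel_measurable sphere_measure"
    using assms by (simp_all add: square_integrable_def)
  have "cnj \<in> borel_measurable borel"
    by (intro borel_measurable_continuous_onI continuous_intros)
  then have [measurable]: "(\<lambda>x. cnj (f x)) \<in> borel_measurable sphere_measure"
    by measurable
  show "(\<lambda>x. cnj (f x) * h x) \<in> borel_measurable sphere_measure"
    by measurable
  have "cmod (f x) * cmod (h x) \<le> (cmod (f x))\<^sup>2 + (cmod (h x))\<^sup>2" for x
    using sum_squares_bound[of "cmod (f x)" "cmod (h x)"]
      mult_nonneg_nonneg[OF norm_ge_zero[of "f x"] norm_ge_zero[of "h x"]] by linarith
  then show "AE x in sphere_measure.
      cmod (cnj (f x) * h x) \<le> norm ((cmod (f x))\<^sup>2 + (cmod (h x))\<^sup>2)"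
    by (simp add: norm_mult)
qed

text \<open>The inner product of the combination with the \<open>j\<close>-th component is \<open>c j\<close>.\<close>

lemma orthonormal_components_independent:
  fixes I :: "real^3 \<Rightarrow> complex^'d"
  assumes I: "orthonormal_basis_function G \<Gamma> I"
    and zero: "\<And>x. x \<in> sphere 0 1 \<Longrightarrow> (\<Sum>i\<in>UNIV. c i * I x $ i) = 0"
  shows "c j = 0"
proof -
  have sq: "square_integrable (\<lambda>x. I x $ i)" for i
    using I by (simp add: orthonormal_basis_function_def)
  have orth: "sphere_inner (\<lambda>x. I x $ i) (\<lambda>x. I x $ j) = (if i = j then 1 else 0)" for i j
    using I by (simp add: orthonormal_basis_function_def)
  have "0 = sphere_inner (\<lambda>x. I x $ j) (\<lambda>x. \<Sum>i\<in>UNIV. c i * I x $ i)"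
    unfolding sphere_inner_def
    by (subst Bochner_Integration.integral_cong[OF refl, where g = "\<lambda>_. 0"]) (auto simp: zero)
  also have "\<dots> = (LINT x|sphere_measure. (\<Sum>i\<in>UNIV. c i * (cnj (I x $ j) * I x $ i)))"
    by (simp add: sphere_inner_def sum_distrib_left mult.left_commute)
  also have "\<dots> = (\<Sum>i\<in>UNIV. c i * sphere_inner (\<lambda>x. I x $ j) (\<lambda>x. I x $ i))"
    by (subst Bochner_Integration.integral_sum)
      (simp_all add: sphere_inner_def integrable_cnj_mult_square_integrable[OF sq sq])
  also have "\<dots> = c j"
    by (simp add: orth if_distrib cong: if_cong)
  finally show ?thesis by simp
qed

lemma polyhedral_group_rotation_matrix:
  "polyhedral_group G \<Longrightarrow> g \<in> G \<Longrightarrow> rotation_matrix g"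
  by (auto simp: polyhedral_group_def rotational_symmetry_group_def)

lemma matrix_inv_rotation_sphere:
  fixes g :: "real^'n^'n"
  assumes "rotation_matrix g" and "x \<in> sphere 0 1"
  shows "matrix_inv g *v x \<in> sphere 0 1"
proof -
  have g: "orthogonal_matrix g"
    using assms(1) by (simp add: rotation_matrix_def)
  then have "\<exists>B. g ** B = mat 1 \<and> B ** g = mat 1"
    unfolding orthogonal_matrix_def by blast
  then have "matrix_inv g ** g = mat 1"
    unfolding matrix_inv_def by (rule someI2_ex) blast
  then have "matrix_inv g = transpose g"
    using g by (metis matrix_mul_assoc matrix_mul_lid matrix_mul_rid orthogonal_matrix_def)
  then have "orthogonal_matrix (matrix_inv g)"
    using g by (simp add: orthogonal_matrix_transpose)
  then have "orthogonal_transformation ((*v) (matrix_inv g))"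
    by (simp add: orthogonal_transformation_matrix)
  then show ?thesis
    using assms(2) by (simp add: orthogonal_transformation_norm)
qed

lemma unitary_real_imp_orthogonal:
  fixes A :: "complex^'n^'n"
  assumes unitary: "unitary_matrix A" and real: "\<And>i k. Im (A $ i $ k) = 0"
  obtains Q :: "real^'n^'n" where "orthogonal_matrix Q" "A = map_matrix complex_of_real Q"
proof
  let ?Q = "(\<chi> i k. Re (A $ i $ k)) :: real^'n^'n"
  show A: "A = map_matrix complex_of_real ?Q"
    using real by (simp add: vec_eq_iff complex_eq_iff map_matrix_def)
  have "conj_transpose A ** A = mat 1"
    using unitary by (simp add: unitary_matrix_def)
  then have "Re ((conj_transpose A ** A) $ i $ k) = Re (mat 1 $ i $ k)" for i k
    by simp
  then have "transpose ?Q ** ?Q = mat 1"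
    by (simp add: vec_eq_iff matrix_matrix_mult_def conj_transpose_def transpose_def mat_def
        real if_distrib cong: if_cong)
  then show "orthogonal_matrix ?Q"
    by (simp add: orthogonal_matrix)
qed

theorem proposition1:
  fixes G :: "(real^3^3) set"
    and \<Gamma> :: "real^3^3 \<Rightarrow> complex^'d^'d"
    and I :: "real^3 \<Rightarrow> complex^'d"
  assumes "polyhedral_group G"
    and "irreducible_unitary_representation G \<Gamma>"
    and "orthonormal_basis_function G \<Gamma> I"
    and "\<forall>x\<in>sphere 0 1. \<forall>i. I x $ i \<in> \<real>"
  shows "\<forall>g\<in>G. \<exists>Q :: real^'d^'d. orthogonal_matrix Q \<and> \<Gamma> g = map_matrix complex_of_real Q"
proof
  fix g assume g: "g \<in> G"
  have "Im (\<Gamma> g $ i $ k) = 0" for i k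
  proof -
    have "(\<Sum>i\<in>UNIV. complex_of_real (Im (\<Gamma> g $ i $ k)) * I x $ i) = 0"
      if x: "x \<in> sphere 0 1" for x
    proof -
      have Im_I: "Im (I x $ i) = 0" for i
        using assms(4) x by (simp add: complex_is_Real_iff)
      have "matrix_inv g *v x \<in> sphere 0 1"
        using matrix_inv_rotation_sphere polyhedral_group_rotation_matrix assms(1) g x by blast
      then have "Im (I (matrix_inv g *v x) $ k) = 0"
        using assms(4) complex_is_Real_iff by blast
      moreover have "I (matrix_inv g *v x) = transpose (\<Gamma> g) *v I x"
        using assms(3) g x by (simp add: orthonormal_basis_function_def rotation_op_def)
      ultimately have "Im (\<Sum>i\<in>UNIV. \<Gamma> g $ i $ k * I x $ i) = 0"
        by (simp add: matrix_vector_mult_def transpose_def)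
      then show ?thesis
        by (simp add: complex_eq_iff Im_I)
    qed
    then have "complex_of_real (Im (\<Gamma> g $ i $ k)) = 0"
      by (rule orthonormal_components_independent[OF assms(3)])
    then show ?thesis by simp
  qed
  moreover have "unitary_matrix (\<Gamma> g)"
    using assms(2) g
    by (simp add: irreducible_unitary_representation_def unitary_representation_def)
  ultimately show "\<exists>Q :: real^'d^'d. orthogonal_matrix Q \<and> \<Gamma> g = map_matrix complex_of_real Q"
    using unitary_real_imp_orthogonal by metis
qed

end
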